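(* Suppose $\mathbf{F}_1(s)$ and $\mathbf{F}_2(s)$ are admissible Dirichlet series with the same abscissa of convergence $\alpha$. Then the product $\mathbf{F}_1(s)\cdot\mathbf{F}_2(s)$ is admissible.
   Context: Write $s=\sigma+it$. Suppose $\mathbf{F}(s)$ satisfies: (A1) $\mathbf{F}(s)=\sum_{n\ge1}f(n)n^{-s}$ is a Dirichlet series with nonnegative real coefficients and $f(1)>0$; (A2) its abscissa of (absolute) convergence is $\alpha\in[0,\infty)$; (A3) $\mathbf{F}(s)$ has no zeros in the half-plane $\sigma>\alpha$. Then $\mathbf{F}(s)=e^{\mathbf{H}(s)}$ for $\sigma>\alpha$, where $\mathbf{H}$ is the holomorphic logarithm of $\mathbf{F}$ that is real on $(\alpha,\infty)$. Put $\mathbf{a}=\mathbf{H}'$, $\mathbf{b}=\mathbf{H}''$ (complex derivatives), and define the remainder $\mathsf{R}$ by $\mathbf{H}(\sigma+it)=\mathbf{H}(\sigma)+i\mathbf{a}(\sigma)t-\tfrac{\mathbf{b}(\sigma)}{2}t^2+\mathsf{R}(\sigma+it)$ for $\sigma>\alpha$, $t\in\mathbb{R}$. $\mathbf{F}$ is called admissible if it satisfies (A1)-(A3) and there are $\beta>\alpha$ and a function $\delta:(\alpha,\beta)\to(0,1)$ such that, as $\sigma\to\alpha^+$: (A4) $\delta(\sigma)\to0$; (A5) $\sigma^2\mathbf{b}(\sigma)\to\infty$; (A6) $\mathbf{b}(\sigma)\exp\big(-\mathbf{b}(\sigma)\delta(\sigma)^2\big)\to0$; (A7) $\mathsf{R}(\sigma+it)\to0$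 uniformly for $|t|\le\delta(\sigma)$; (A8) $\displaystyle\frac{\sigma\sqrt{\mathbf{b}(\sigma)}}{\mathbf{F}(\sigma)}\int_{|t|\ge\delta(\sigma)}|\mathbf{F}(\sigma+it)|\,\frac{dt}{\sigma^2+t^2}\to0$. *)

theory Defs
  imports "HOL-Complex_Analysis.Complex_Analysis"
begin

text \<open>
  Dirichlet series \<open>\<Sum>n\<ge>1. f n / n ^ s\<close> are given by their coefficients \<open>f\<close>. Since
  \<open>0 powr z = 0\<close>, the index \<open>0\<close> contributes nothing and \<open>f 0\<close> is irrelevant.
\<close>

definition dirichlet_term :: "(nat \<Rightarrow> real) \<Rightarrow> complex \<Rightarrow> nat \<Rightarrow> complex" where
  "dirichlet_term f s n = of_real (f n) * of_nat n powr (- s)"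

definition dirichlet_abscissa :: "(nat \<Rightarrow> real) \<Rightarrow> ereal" where
  "dirichlet_abscissa f =
     (INF s\<in>{s. summable (\<lambda>n. norm (dirichlet_term f s n))}. ereal (Re s))"

definition nonneg_dirichlet_series :: "real \<Rightarrow> (complex \<Rightarrow> complex) \<Rightarrow> bool" where
  "nonneg_dirichlet_series \<alpha> F \<longleftrightarrow>
     (\<exists>f. (\<forall>n\<ge>1. f n \<ge> 0) \<and> f 1 > 0 \<and> dirichlet_abscissa f = ereal \<alpha> \<and>
          (\<forall>s. Re s > \<alpha> \<longrightarrow> dirichlet_term f s sums F s))"

definition is_real_log :: "real \<Rightarrow> (complex \<Rightarrow> complex) \<Rightarrow> (complex \<Rightarrow> complex) \<Rightarrow> bool" where
  "is_real_log \<alpha> F H \<longleftrightarrow>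
     H holomorphic_on {s. Re s > \<alpha>} \<and>
     (\<forall>s. Re s > \<alpha> \<longrightarrow> F s = exp (H s)) \<and>
     (\<forall>\<sigma>>\<alpha>. H (of_real \<sigma>) \<in> \<real>)"

text \<open>
  The choice below is determined on the half-plane \<open>Re s > \<alpha>\<close>, the only place where it is
  used: see \<open>is_real_log_unique\<close> and \<open>is_real_log_exists\<close>.
\<close>

definition real_log :: "real \<Rightarrow> (complex \<Rightarrow> complex) \<Rightarrow> complex \<Rightarrow> complex" where
  "real_log \<alpha> F = (SOME H. is_real_log \<alpha> F H)"

lemma is_real_log_unique:
  assumes "is_real_log \<alpha> F H" "is_real_log \<alpha> F H'" "Re s > \<alpha>"
  shows "H s = H' s"
proof -
  let ?S = "{s. Re s > \<alpha>}"
  have hol: "(\<lambda>s. H s - H' s) holomorphic_on ?S"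
    using assms by (auto simp: is_real_log_def intro!: holomorphic_intros)
  have ints: "\<exists>k::int. H s - H' s = of_int k * (2 * pi * \<i>)" if "s \<in> ?S" for s
  proof -
    have "exp (H s) = exp (H' s)"
      using assms that by (auto simp: is_real_log_def)
    then obtain k :: int where "H s = H' s + (of_int (2 * k) * pi) * \<i>"
      by (auto simp: exp_eq)
    then show ?thesis
      by (intro exI[of _ k]) (simp add: algebra_simps)
  qed
  have conn: "connected ?S"
    by (intro convex_connected convex_halfspace_Re_gt)
  have "(\<lambda>s. H s - H' s) constant_on ?S"
  proof (rule continuous_discrete_range_constant[OF conn holomorphic_on_imp_continuous_on[OF hol]])
    fix x assume x: "x \<in> ?S"
    show "\<exists>e>0. \<forall>y. y \<in> ?S \<and> H y - H' y \<noteq> H x - H' x \<longrightarrow> e \<le> norm (H y - H' y - (H x - H' x))"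
    proof (intro exI[of _ "2 * pi"] conjI allI impI)
      fix y assume y: "y \<in> ?S \<and> H y - H' y \<noteq> H x - H' x"
      obtain k l :: int where kl: "H x - H' x = of_int k * (2 * pi * \<i>)" "H y - H' y = of_int l * (2 * pi * \<i>)"
        using ints x y by blast
      with y have "l \<noteq> k" by auto
      have "norm (H y - H' y - (H x - H' x)) = norm (of_int (l - k) * (2 * pi * \<i>))"
        unfolding kl by (simp add: algebra_simps)
      also have "\<dots> = \<bar>of_int (l - k)\<bar> * (2 * pi)"
        by (simp only: norm_mult norm_of_int) (simp add: norm_mult)
      also have "\<dots> \<ge> 1 * (2 * pi)"
        using \<open>l \<noteq> k\<close> by (intro mult_right_mono) (linarith, simp)
      finally show "2 * pi \<le> norm (H y - H' y - (H x - H' x))" by simp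
    qed simp
  qed
  then obtain c where c: "\<And>s. s \<in> ?S \<Longrightarrow> H s - H' s = c"
    by (auto simp: constant_on_def)
  let ?x = "of_real (\<alpha> + 1) :: complex"
  have "H ?x - H' ?x \<in> \<real>"
    using assms by (auto simp: is_real_log_def simp del: of_real_add intro!: Reals_diff)
  moreover obtain k :: int where "H ?x - H' ?x = of_int k * (2 * pi * \<i>)"
    using ints[of ?x] by auto
  ultimately have "H ?x - H' ?x = 0"
    by (simp add: complex_eq_iff complex_is_Real_iff del: of_real_add)
  then have "c = 0" using c[of ?x] by simp
  then show ?thesis using c[of s] assms(3) by simp
qed

lemma is_real_log_exists:
  assumes "F holomorphic_on {s. Re s > \<alpha>}" "\<And>s. Re s > \<alpha> \<Longrightarrow> F s \<noteq> 0"
    and "\<And>\<sigma>. \<sigma> > \<alpha> \<Longrightarrow> F (of_real \<sigma>) \<in> \<real> \<and> Re (F (of_real \<sigma>)) > 0"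
  shows "is_real_log \<alpha> F (real_log \<alpha> F)"
proof -
  let ?S = "{s. Re s > \<alpha>}"
  have contr: "contractible ?S"
    by (intro convex_imp_contractible convex_halfspace_Re_gt)
  obtain G where G: "G holomorphic_on ?S" "\<And>s. s \<in> ?S \<Longrightarrow> F s = exp (G s)"
    using contractible_imp_holomorphic_log[OF assms(1) contr] assms(2) by blast
  let ?x = "of_real (\<alpha> + 1) :: complex"
  define H where "H = (\<lambda>s. G s - \<i> * of_real (Im (G ?x)))"
  have eq1: "exp (\<i> * of_real (Im (G ?x))) = 1"
  proof -
    define z where "z = G ?x"
    have F: "F ?x \<in> \<real>" "Re (F ?x) > 0" "F ?x = exp z"
      using assms(3)[of "\<alpha> + 1"] G(2)[of ?x] by (simp_all add: z_def del: of_real_add)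
    have "F ?x = of_real (norm (F ?x))"
      using F(1,2) by (simp add: complex_eq_iff complex_is_Real_iff cmod_eq_Re)
    then have "exp z = of_real (exp (Re z))"
      using F(3) by simp
    moreover have "exp z = of_real (exp (Re z)) * exp (\<i> * of_real (Im z))"
      by (metis exp_eq_polar cis_conv_exp)
    ultimately show ?thesis by (simp add: z_def)
  qed
  have H: "H holomorphic_on ?S" "\<And>s. s \<in> ?S \<Longrightarrow> F s = exp (H s)"
    using G eq1 by (auto simp: H_def exp_diff intro!: holomorphic_intros)
  have "(\<lambda>\<sigma>. Im (H (of_real \<sigma>))) constant_on {\<alpha><..}"
  proof (rule continuous_discrete_range_constant)
    show "continuous_on {\<alpha><..} (\<lambda>\<sigma>. Im (H (of_real \<sigma>)))"
      by (intro continuous_intros continuous_on_compose2[OF holomorphic_on_imp_continuous_on[OF H(1)]]) auto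
    have ints: "\<exists>k::int. Im (H (of_real \<sigma>)) = of_int k * (2 * pi)" if "\<sigma> > \<alpha>" for \<sigma>
    proof -
      define z where "z = H (of_real \<sigma>)"
      have F: "F \<sigma> \<in> \<real>" "Re (F \<sigma>) > 0" "F \<sigma> = exp z"
        using assms(3)[of \<sigma>] H(2)[of \<sigma>] that by (simp_all add: z_def)
      have "cos (Im z) = 1"
      proof -
        have "Im (F \<sigma>) = 0" using F(1) by (simp add: complex_is_Real_iff)
        then have "sin (Im z) = 0" using F(3) by (simp add: Im_exp)
        moreover have "cos (Im z) > 0" using F(2,3) by (simp add: Re_exp zero_less_mult_iff)
        ultimately show ?thesis using sin_zero_abs_cos_one[of "Im z"] by linarith
      qed
      then show ?thesis by (simp add: cos_one_2pi_int z_def mult_ac)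
    qed
    fix x assume x: "x \<in> {\<alpha><..}"
    show "\<exists>e>0. \<forall>y. y \<in> {\<alpha><..} \<and> Im (H (of_real y)) \<noteq> Im (H (of_real x)) \<longrightarrow>
            e \<le> norm (Im (H (of_real y)) - Im (H (of_real x)))"
    proof (intro exI[of _ "2 * pi"] conjI allI impI)
      fix y assume y: "y \<in> {\<alpha><..} \<and> Im (H (of_real y)) \<noteq> Im (H (of_real x))"
      obtain k l :: int where kl: "Im (H (of_real x)) = of_int k * (2 * pi)" "Im (H (of_real y)) = of_int l * (2 * pi)"
        using ints x y by (metis greaterThan_iff)
      with y have "l \<noteq> k" by auto
      have "norm (Im (H (of_real y)) - Im (H (of_real x))) = norm (of_int (l - k) * (2 * pi))"
        unfolding kl by (simp add: algebra_simps)
      also have "\<dots> = \<bar>of_int (l - k)\<bar> * (2 * pi)"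
        by (simp add: abs_mult)
      also have "\<dots> \<ge> 1 * (2 * pi)"
        using \<open>l \<noteq> k\<close> by (intro mult_right_mono) (linarith, simp)
      finally show "2 * pi \<le> norm (Im (H (of_real y)) - Im (H (of_real x)))" by simp
    qed simp
  qed (auto intro: connected_Ioi)
  then obtain c where c: "\<And>\<sigma>. \<sigma> > \<alpha> \<Longrightarrow> Im (H (of_real \<sigma>)) = c"
    by (auto simp: constant_on_def)
  moreover have "Im (H ?x) = 0"
    by (simp add: H_def)
  ultimately have "Im (H (of_real \<sigma>)) = 0" if "\<sigma> > \<alpha>" for \<sigma>
    using c[of "\<alpha> + 1"] c[of \<sigma>] that by simp
  with H have "is_real_log \<alpha> F H"
    by (auto simp: is_real_log_def complex_is_Real_iff)
  then show ?thesis
    unfolding real_log_def by (metis someI)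
qed

definition log_remainder :: "(complex \<Rightarrow> complex) \<Rightarrow> complex \<Rightarrow> complex" where
  "log_remainder H s =
     (let \<sigma> = of_real (Re s); t = of_real (Im s)
      in H s - (H \<sigma> + \<i> * deriv H \<sigma> * t - deriv (deriv H) \<sigma> / 2 * t\<^sup>2))"

text \<open>
  \<open>admissible \<alpha> F\<close>: \<open>F\<close> is admissible with abscissa of convergence \<open>\<alpha>\<close>; only the values of
  \<open>F\<close> on \<open>Re s > \<alpha>\<close> matter. On the real axis to the right of \<open>\<alpha>\<close> both \<open>F\<close> and the second
  derivative of its logarithm are real-valued, so \<open>Re\<close> is merely a type conversion there.
\<close>

definition admissible :: "real \<Rightarrow> (complex \<Rightarrow> complex) \<Rightarrow> bool" where
  "admissible \<alpha> F \<longleftrightarrow>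
     0 \<le> \<alpha> \<and> nonneg_dirichlet_series \<alpha> F \<and> (\<forall>s. Re s > \<alpha> \<longrightarrow> F s \<noteq> 0) \<and>
     (let H = real_log \<alpha> F;
          b = (\<lambda>\<sigma>::real. Re (deriv (deriv H) (of_real \<sigma>)))
      in \<exists>\<beta> \<delta>. \<beta> > \<alpha> \<and> (\<forall>\<sigma>. \<alpha> < \<sigma> \<and> \<sigma> < \<beta> \<longrightarrow> 0 < \<delta> \<sigma> \<and> \<delta> \<sigma> < 1) \<and>
           (\<delta> \<longlongrightarrow> 0) (at_right \<alpha>) \<and>
           filterlim (\<lambda>\<sigma>. \<sigma>\<^sup>2 * b \<sigma>) at_top (at_right \<alpha>) \<and>
           ((\<lambda>\<sigma>. b \<sigma> * exp (- (b \<sigma> * (\<delta> \<sigma>)\<^sup>2))) \<longlongrightarrow> 0) (at_right \<alpha>) \<and>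
           (\<forall>\<epsilon>>0. \<forall>\<^sub>F \<sigma> in at_right \<alpha>. \<forall>t. \<bar>t\<bar> \<le> \<delta> \<sigma> \<longrightarrow>
              norm (log_remainder H (Complex \<sigma> t)) < \<epsilon>) \<and>
           ((\<lambda>\<sigma>. \<sigma> * sqrt (b \<sigma>) / Re (F (of_real \<sigma>)) *
               (LINT t:{t. \<bar>t\<bar> \<ge> \<delta> \<sigma>}|lborel. norm (F (Complex \<sigma> t)) / (\<sigma>\<^sup>2 + t\<^sup>2)))
             \<longlongrightarrow> 0) (at_right \<alpha>))"

end

theory Submission
  imports Defs "HOL-Probability.Sinc_Integral"
begin

text \<open>
  The logarithm of the product is the sum of the logarithms, so its second derivative is
  \<open>b = b1 + b2\<close> and its remainder is the sum of the remainders. The range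
  \<open>\<delta> = min \<delta>1 \<delta>2\<close> works for the product. Conditions (A5) and (A6) for \<open>F\<^sub>i\<close> force
  \<open>b\<^sub>i \<delta>\<^sub>i\<^sup>2 \<ge> 1\<close> near \<open>\<alpha>\<close>, where \<open>x \<mapsto> x exp (- x \<delta>\<^sub>i\<^sup>2)\<close> is decreasing; this yields (A6).
  For (A8), say with \<open>\<delta>1 \<le> \<delta>2\<close>, split \<open>sqrt b \<le> sqrt b1 + sqrt b2\<close>. In the part with
  \<open>sqrt b1\<close> bound \<open>\<bar>F\<^sub>2\<bar>\<close> by its value on the real axis. In the part with \<open>sqrt b2\<close> do the same
  for \<open>\<bar>F\<^sub>1\<bar>\<close> on \<open>\<bar>t\<bar> \<ge> \<delta>2\<close>, while on \<open>\<delta>1 \<le> \<bar>t\<bar> \<le> \<delta>2\<close> the Gaussian decay of \<open>F\<^sub>2\<close> given by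
  (A7) compensates the excess of \<open>b2\<close> over \<open>b1\<close>.
\<close>

section \<open>Absolute convergence and holomorphy of Dirichlet series\<close>

lemma norm_dirichlet_term: "norm (dirichlet_term f s n) = \<bar>f n\<bar> * real n powr - Re s"
  by (cases "n = 0") (simp_all add: dirichlet_term_def norm_mult norm_powr_real_powr)

lemma dirichlet_term_of_real:
  "dirichlet_term f (of_real \<sigma>) n = of_real (f n * real n powr - \<sigma>)"
  unfolding dirichlet_term_def
  using powr_of_real[of "real n" "-\<sigma>"] by simp

lemma norm_dirichlet_term_mono:
  assumes "Re z \<le> Re s"
  shows "norm (dirichlet_term f s n) \<le> norm (dirichlet_term f z n)"
proof (cases "n = 0")
  case False
  then show ?thesis
    using assms unfolding norm_dirichlet_term
    by (intro mult_left_mono powr_mono) auto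
qed (simp add: norm_dirichlet_term)

text \<open>The abscissa is an infimum, so some point of absolute convergence lies strictly to the
  left of \<open>s\<close>; its terms dominate those at \<open>s\<close>.\<close>

lemma abs_summable_dirichlet_gt_abscissa:
  assumes "dirichlet_abscissa f < ereal (Re s)"
  shows "summable (\<lambda>n. norm (dirichlet_term f s n))"
proof -
  obtain z where z: "summable (\<lambda>n. norm (dirichlet_term f z n))" "Re z < Re s"
    using assms unfolding dirichlet_abscissa_def INF_less_iff by auto
  show ?thesis
    by (rule summable_comparison_test[OF _ z(1)])
      (use z(2) in \<open>auto intro!: exI[of _ 0] norm_dirichlet_term_mono\<close>)
qed

text \<open>On a closed disc inside the half-plane the terms at its smallest real part dominate all
  others, and they are absolutely summable. The M-test then makes the partial sums converge locally
  uniformly.\<close>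

lemma dirichlet_series_holomorphic:
  assumes abscissa: "dirichlet_abscissa f \<le> ereal \<alpha>"
    and sums: "\<And>s. Re s > \<alpha> \<Longrightarrow> dirichlet_term f s sums F s"
  shows "F holomorphic_on {s. Re s > \<alpha>}"
proof (rule holomorphic_uniform_sequence)
  show "open {s. Re s > \<alpha>}" by (rule open_halfspace_Re_gt)
  show "(\<lambda>s. \<Sum>n<N. dirichlet_term f s n) holomorphic_on {s. Re s > \<alpha>}" for N
  proof (intro holomorphic_on_sum)
    fix n
    show "(\<lambda>s. dirichlet_term f s n) holomorphic_on {s. Re s > \<alpha>}"
      unfolding dirichlet_term_def
      by (cases "n = 0") (auto intro!: holomorphic_intros)
  qed
  fix x assume "x \<in> {s. Re s > \<alpha>}"
  then have x: "Re x > \<alpha>" by simp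
  \<comment> \<open>Half the distance to the boundary line keeps the closed disc strictly inside the
    half-plane.\<close>
  define d where "d = (Re x - \<alpha>) / 2"
  have d: "d > 0" "\<alpha> < Re x - d" using x by (auto simp: d_def field_simps)
  have Re_ge: "Re x - d \<le> Re z" if "z \<in> cball x d" for z
    using that abs_Re_le_cmod[of "x - z"] by (simp add: dist_norm)
  have sum: "summable (\<lambda>n. norm (dirichlet_term f (of_real (Re x - d)) n))"
    using abscissa d by (intro abs_summable_dirichlet_gt_abscissa) (auto intro: le_less_trans)
  have "uniform_limit (cball x d) (\<lambda>N s. \<Sum>n<N. dirichlet_term f s n)
          (\<lambda>s. \<Sum>n. dirichlet_term f s n) sequentially"
    by (rule Weierstrass_m_test[OF _ sum]) (use Re_ge in \<open>auto intro!: norm_dirichlet_term_mono\<close>)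
  moreover have "(\<Sum>n. dirichlet_term f s n) = F s" if "s \<in> cball x d" for s
    using sums[of s] Re_ge[OF that] d by (simp add: sums_iff)
  ultimately have "uniform_limit (cball x d) (\<lambda>N s. \<Sum>n<N. dirichlet_term f s n) F sequentially"
    by (subst (asm) uniform_limit_cong'[where g = "\<lambda>N s. \<Sum>n<N. dirichlet_term f s n" and i = F]) auto
  moreover have "cball x d \<subseteq> {s. Re s > \<alpha>}"
    using Re_ge d by fastforce
  ultimately show "\<exists>d>0. cball x d \<subseteq> {s. Re s > \<alpha>} \<and>
      uniform_limit (cball x d) (\<lambda>N s. \<Sum>n<N. dirichlet_term f s n) F sequentially"
    using d by blast
qed

section \<open>Products of Dirichlet series\<close>

text \<open>At \<open>n = 0\<close> the sum ranges over an infinite set, so the convolution is \<open>0\<close> there.\<close>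

definition dirichlet_conv :: "(nat \<Rightarrow> real) \<Rightarrow> (nat \<Rightarrow> real) \<Rightarrow> nat \<Rightarrow> real" where
  "dirichlet_conv f g n = (\<Sum>d | d dvd n. f d * g (n div d))"

text \<open>Complex \<open>powr\<close> is not multiplicative in general, but it is for nonnegative
  real bases such as \<open>d\<close> and \<open>n div d\<close>.\<close>

lemma dirichlet_term_conv:
  assumes "n > 0"
  shows "dirichlet_term (dirichlet_conv f g) s n =
    (\<Sum>d | d dvd n. dirichlet_term f s d * dirichlet_term g s (n div d))"
proof -
  have "of_nat d powr (-s) * of_nat (n div d) powr (-s) = (of_nat n powr (-s) :: complex)"
    if "d dvd n" for d
  proof -
    have "(of_real (real d) * of_real (real (n div d))) powr (-s) =
        (of_real (real d) powr (-s) * of_real (real (n div d)) powr (-s) :: complex)"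
      by (intro powr_times_real) auto
    moreover have "of_nat n = (of_nat d * of_nat (n div d) :: complex)"
      using that by (metis dvd_mult_div_cancel of_nat_mult)
    ultimately show ?thesis by simp
  qed
  then show ?thesis
    unfolding dirichlet_term_def dirichlet_conv_def of_real_sum sum_distrib_right
    by (intro sum.cong) (auto simp: mult_ac)
qed

lemma dirichlet_term_0 [simp]: "dirichlet_term f s 0 = 0"
  by (simp add: dirichlet_term_def)

text \<open>Absolute convergence turns the product of the sums into a double sum over pairs of
  positive integers, which is then regrouped by the product of the pair.\<close>

lemma dirichlet_conv_has_sum:
  assumes f: "summable (\<lambda>n. norm (dirichlet_term f s n))"
    and g: "summable (\<lambda>n. norm (dirichlet_term g s n))"
    and F: "dirichlet_term f s sums F" and G: "dirichlet_term g s sums G"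
  shows "(dirichlet_term (dirichlet_conv f g) s has_sum F * G) UNIV"
proof -
  let ?a = "dirichlet_term f s" and ?b = "dirichlet_term g s"
  let ?P = "{0<..} :: nat set"
  \<comment> \<open>The term at \<open>0\<close> vanishes, so all sums may run over positive
    indices, each of which has only finitely many divisors.\<close>
  have positive: "(dirichlet_term h s has_sum x) ?P \<longleftrightarrow> (dirichlet_term h s has_sum x) UNIV" for h x
    by (intro has_sum_cong_neutral) auto
  have abs: "(\<lambda>n. norm (dirichlet_term h s n)) summable_on ?P"
    if "summable (\<lambda>n. norm (dirichlet_term h s n))" for h
    using that by (intro summable_on_subset_banach[OF norm_summable_imp_summable_on]) auto
  have a: "(?a has_sum F) ?P" and b: "(?b has_sum G) ?P"
    unfolding positive using assms by (auto intro: norm_summable_imp_has_sum)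
  have "(\<lambda>p. norm (case p of (m, n) \<Rightarrow> ?a m * ?b n)) summable_on ?P \<times> ?P"
  proof (rule summable_on_SigmaI)
    show "((\<lambda>n. norm (case (m, n) of (m, n) \<Rightarrow> ?a m * ?b n)) has_sum
        norm (?a m) * (\<Sum>\<^sub>\<infinity>n\<in>?P. norm (?b n))) ?P" for m
      using has_sum_cmult_right[OF has_sum_infsum[OF abs[OF g]]] by (simp add: norm_mult)
    show "(\<lambda>m. norm (?a m) * (\<Sum>\<^sub>\<infinity>n\<in>?P. norm (?b n))) summable_on ?P"
      by (intro summable_on_cmult_left abs f)
  qed auto
  then have summable: "(\<lambda>(m, n). ?a m * ?b n) summable_on ?P \<times> ?P"
    by (rule abs_summable_summable)
  have "((\<lambda>(m, n). ?a m * ?b n) has_sum F * G) (?P \<times> ?P)"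
    by (rule has_sum_SigmaI[where g = "\<lambda>m. ?a m * G"])
      (use summable in \<open>auto intro!: has_sum_cmult_right has_sum_cmult_left a b\<close>)
  \<comment> \<open>The pair \<open>(m, n)\<close> is encoded as \<open>(m * n, m)\<close>: the
    product together with its first factor as a divisor.\<close>
  also have "?this \<longleftrightarrow>
      ((\<lambda>(n, d). ?a d * ?b (n div d)) has_sum F * G) (Sigma ?P (\<lambda>n. {d. d dvd n}))"
    by (rule has_sum_reindex_bij_witness[where j = "\<lambda>(m, n). (m * n, m)"
          and i = "\<lambda>(n, d). (d, n div d)"]) (auto simp: div_greater_zero_iff dvd_imp_le dest: dvd_pos_nat)
  finally have "((\<lambda>n. \<Sum>d | d dvd n. ?a d * ?b (n div d)) has_sum F * G) ?P"
    by (rule has_sum_Sigma') (auto intro!: has_sum_finite)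
  also have "?this \<longleftrightarrow> (dirichlet_term (dirichlet_conv f g) s has_sum F * G) ?P"
    by (intro has_sum_cong) (simp add: dirichlet_term_conv)
  finally show ?thesis unfolding positive .
qed

text \<open>The delicate point is that the abscissa is exactly \<open>\<alpha>\<close>. Convergence
  for \<open>Re s > \<alpha>\<close> bounds it from above. From below, nonnegativity gives
  \<open>f n * g 1 \<le> ?h n\<close>, so the product converges absolutely only where the series of
  \<open>f\<close> does.\<close>

lemma nonneg_dirichlet_series_mult:
  assumes "nonneg_dirichlet_series \<alpha> F" "nonneg_dirichlet_series \<alpha> G"
  shows "nonneg_dirichlet_series \<alpha> (\<lambda>s. F s * G s)"
proof -
  obtain f where f: "\<And>n. n \<ge> 1 \<Longrightarrow> f n \<ge> 0" "f 1 > 0" "dirichlet_abscissa f = ereal \<alpha>"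
      "\<And>s. Re s > \<alpha> \<Longrightarrow> dirichlet_term f s sums F s"
    using assms(1) unfolding nonneg_dirichlet_series_def by blast
  obtain g where g: "\<And>n. n \<ge> 1 \<Longrightarrow> g n \<ge> 0" "g 1 > 0" "dirichlet_abscissa g = ereal \<alpha>"
      "\<And>s. Re s > \<alpha> \<Longrightarrow> dirichlet_term g s sums G s"
    using assms(2) unfolding nonneg_dirichlet_series_def by blast
  let ?h = "dirichlet_conv f g"
  have has_sum: "(dirichlet_term ?h s has_sum F s * G s) UNIV" if "Re s > \<alpha>" for s
    using that f g by (intro dirichlet_conv_has_sum abs_summable_dirichlet_gt_abscissa) auto
  have terms_nonneg: "f d * g (n div d) \<ge> 0" if "n \<ge> 1" "d dvd n" for n d
    using that dvd_pos_nat[of n d] dvd_imp_le[of d n]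
    by (intro mult_nonneg_nonneg f g) (auto simp: Suc_le_eq div_greater_zero_iff)
  then have nonneg: "?h n \<ge> 0" if "n \<ge> 1" for n
    using that by (auto simp: dirichlet_conv_def intro!: sum_nonneg)
  \<comment> \<open>Only the divisor \<open>d = n\<close> is kept.\<close>
  have ge: "f n * g 1 \<le> ?h n" if "n \<ge> 1" for n
  proof -
    have "(\<Sum>d\<in>{n}. f d * g (n div d)) \<le> ?h n"
      unfolding dirichlet_conv_def using that terms_nonneg by (intro sum_mono2) auto
    with that show ?thesis by simp
  qed
  have "dirichlet_abscissa ?h = ereal \<alpha>"
  proof (rule antisym)
    have le: "dirichlet_abscissa ?h \<le> ereal x" if "x > \<alpha>" for x
    proof -
      \<comment> \<open>For complex families, unconditional summability already means absolute
        summability.\<close>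
      have "dirichlet_term ?h (of_real x) summable_on UNIV"
        using has_sum_imp_summable[OF has_sum[of "of_real x"]] that
        unfolding Re_complex_of_real by blast
      then have "summable (\<lambda>n. norm (dirichlet_term ?h (of_real x) n))"
        unfolding summable_on_iff_abs_summable_on_complex[of "dirichlet_term ?h (of_real x)"]
        by (rule summable_on_imp_summable)
      then show ?thesis
        unfolding dirichlet_abscissa_def by (intro INF_lower2[of "of_real x"]) auto
    qed
    show "dirichlet_abscissa ?h \<le> ereal \<alpha>"
    proof (rule ereal_le_epsilon2)
      show "dirichlet_abscissa ?h \<le> ereal \<alpha> + ereal e" if "e > 0" for e
        using le[of "\<alpha> + e"] that by simp
    qed
    have "ereal \<alpha> \<le> ereal (Re s)" if "summable (\<lambda>n. norm (dirichlet_term ?h s n))" for s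
    proof -
      have "summable (\<lambda>n. norm (dirichlet_term f s n) * g 1)"
      proof (rule summable_comparison_test[OF _ that], intro exI[of _ 0] allI impI)
        fix n
        have "\<bar>f n\<bar> * g 1 \<le> \<bar>?h n\<bar>" if "n \<noteq> 0"
          using ge[of n] f(1)[of n] nonneg[of n] that by simp
        then show "norm (norm (dirichlet_term f s n) * g 1) \<le> norm (dirichlet_term ?h s n)"
          using g(2) mult_right_mono[of "\<bar>f n\<bar> * g 1" "\<bar>?h n\<bar>" "real n powr - Re s"]
          by (cases "n = 0") (auto simp: norm_dirichlet_term abs_mult mult_ac)
      qed
      then have "summable (\<lambda>n. norm (dirichlet_term f s n))"
        using g(2) summable_mult2[of "\<lambda>n. norm (dirichlet_term f s n) * g 1" "inverse (g 1)"]
        by (simp add: mult.assoc)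
      then show ?thesis
        unfolding f(3)[symmetric] dirichlet_abscissa_def by (intro INF_lower) auto
    qed
    then show "ereal \<alpha> \<le> dirichlet_abscissa ?h"
      unfolding dirichlet_abscissa_def by (intro INF_greatest) auto
  qed
  moreover have "?h 1 > 0"
    using f(2) g(2) by (simp add: dirichlet_conv_def)
  ultimately show ?thesis
    unfolding nonneg_dirichlet_series_def using nonneg has_sum
    by (intro exI[of _ ?h]) (auto intro: has_sum_imp_sums)
qed

section \<open>Values of series with nonnegative coefficients\<close>

lemma nonneg_dirichlet_series_holomorphic:
  assumes "nonneg_dirichlet_series \<alpha> F"
  shows "F holomorphic_on {s. Re s > \<alpha>}"
proof -
  obtain f where "dirichlet_abscissa f = ereal \<alpha>"
      "\<And>s. Re s > \<alpha> \<Longrightarrow> dirichlet_term f s sums F s"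
    using assms unfolding nonneg_dirichlet_series_def by blast
  then show ?thesis
    by (intro dirichlet_series_holomorphic[of f]) simp_all
qed

text \<open>At a real point all terms are real and nonnegative, and the one with index
  \<open>1\<close> is positive.\<close>

lemma nonneg_dirichlet_series_real_pos:
  assumes "nonneg_dirichlet_series \<alpha> F" "\<sigma> > \<alpha>"
  shows "F (of_real \<sigma>) \<in> \<real>" "Re (F (of_real \<sigma>)) > 0"
proof -
  obtain f where f: "\<And>n. n \<ge> 1 \<Longrightarrow> f n \<ge> 0" "f 1 > 0"
      "\<And>s. Re s > \<alpha> \<Longrightarrow> dirichlet_term f s sums F s"
    using assms(1) unfolding nonneg_dirichlet_series_def by blast
  let ?u = "\<lambda>n. f n * real n powr - \<sigma>"
  have "(\<lambda>n. of_real (?u n)) sums F (of_real \<sigma>)"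
    using f(3)[of "of_real \<sigma>"] assms(2)
    by (simp add: dirichlet_term_of_real[abs_def])
  then have Re: "?u sums Re (F (of_real \<sigma>))" and Im: "(\<lambda>n. 0) sums Im (F (of_real \<sigma>))"
    by (auto simp: sums_complex_iff)
  show "F (of_real \<sigma>) \<in> \<real>"
    using Im by (simp add: complex_is_Real_iff sums_iff)
  have "0 < suminf ?u"
  proof (rule suminf_pos2[of _ 1])
    show "0 \<le> ?u n" for n using f(1)[of n] by (cases "n = 0") auto
  qed (use f(2) Re in \<open>auto simp: sums_iff\<close>)
  then show "Re (F (of_real \<sigma>)) > 0"
    using Re by (simp add: sums_iff)
qed

text \<open>The modulus of each term equals the corresponding term on the real axis; the rest is the
  triangle inequality.\<close>

lemma norm_nonneg_dirichlet_series_le: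
  assumes "nonneg_dirichlet_series \<alpha> F" "\<sigma> > \<alpha>"
  shows "norm (F (Complex \<sigma> t)) \<le> Re (F (of_real \<sigma>))"
proof -
  obtain f where f: "\<And>n. n \<ge> 1 \<Longrightarrow> f n \<ge> 0" "dirichlet_abscissa f = ereal \<alpha>"
      "\<And>s. Re s > \<alpha> \<Longrightarrow> dirichlet_term f s sums F s"
    using assms(1) unfolding nonneg_dirichlet_series_def by blast
  have norm: "norm (dirichlet_term f (Complex \<sigma> t) n) = Re (dirichlet_term f (of_real \<sigma>) n)" for n
    using f(1)[of n] by (cases "n = 0") (auto simp: norm_dirichlet_term dirichlet_term_of_real)
  have sums: "(\<lambda>n. Re (dirichlet_term f (of_real \<sigma>) n)) sums Re (F (of_real \<sigma>))"
    using f(3)[of "of_real \<sigma>"] assms(2) by (simp add: sums_complex_iff)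
  have "F (Complex \<sigma> t) = (\<Sum>n. dirichlet_term f (Complex \<sigma> t) n)"
    using f(3)[of "Complex \<sigma> t"] assms(2) by (simp add: sums_iff)
  also have "norm \<dots> \<le> (\<Sum>n. norm (dirichlet_term f (Complex \<sigma> t) n))"
    using sums unfolding norm[symmetric] by (intro summable_norm) (simp add: sums_iff)
  also have "\<dots> = Re (F (of_real \<sigma>))"
    using sums unfolding norm by (simp add: sums_iff)
  finally show ?thesis .
qed

lemma nonneg_dirichlet_series_is_real_log:
  assumes "nonneg_dirichlet_series \<alpha> F" "\<And>s. Re s > \<alpha> \<Longrightarrow> F s \<noteq> 0"
  shows "is_real_log \<alpha> F (real_log \<alpha> F)"
  using assms nonneg_dirichlet_series_holomorphic nonneg_dirichlet_series_real_pos
  by (intro is_real_log_exists) auto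

section \<open>The logarithm of a product and Gaussian decay\<close>

lemma is_real_log_mult:
  assumes "is_real_log \<alpha> F H" "is_real_log \<alpha> G K"
  shows "is_real_log \<alpha> (\<lambda>s. F s * G s) (\<lambda>s. H s + K s)"
  using assms unfolding is_real_log_def
  by (auto simp: exp_add intro!: holomorphic_intros Reals_add)

lemma deriv_cong_open:
  assumes "open S" "x \<in> S" "\<And>y. y \<in> S \<Longrightarrow> f y = g y"
  shows "deriv f x = deriv g x"
  using assms by (intro deriv_cong_ev) (auto intro: eventually_mono[OF eventually_nhds_in_open])

lemma deriv_add_halfplane:
  assumes H: "H holomorphic_on {s. Re s > \<alpha>}" and K: "K holomorphic_on {s. Re s > \<alpha>}"
    and L: "\<And>s. Re s > \<alpha> \<Longrightarrow> L s = H s + K s" and "Re s > \<alpha>"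
  shows "deriv L s = deriv H s + deriv K s"
proof -
  have "deriv L s = deriv (\<lambda>s. H s + K s) s"
    using assms L by (intro deriv_cong_open[OF open_halfspace_Re_gt[of \<alpha>]]) auto
  also have "\<dots> = deriv H s + deriv K s"
    using assms by (intro deriv_add holomorphic_on_imp_differentiable_at[OF H]
        holomorphic_on_imp_differentiable_at[OF K] open_halfspace_Re_gt) auto
  finally show ?thesis .
qed

lemma deriv_deriv_add_halfplane:
  assumes H: "H holomorphic_on {s. Re s > \<alpha>}" and K: "K holomorphic_on {s. Re s > \<alpha>}"
    and L: "\<And>s. Re s > \<alpha> \<Longrightarrow> L s = H s + K s" and "Re s > \<alpha>"
  shows "deriv (deriv L) s = deriv (deriv H) s + deriv (deriv K) s"
  using assms
  by (intro deriv_add_halfplane[of "deriv H" \<alpha>] holomorphic_deriv open_halfspace_Re_gt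
      deriv_add_halfplane[OF H K L])

lemma log_remainder_add:
  assumes "H holomorphic_on {s. Re s > \<alpha>}" "K holomorphic_on {s. Re s > \<alpha>}"
    and "\<And>s. Re s > \<alpha> \<Longrightarrow> L s = H s + K s" and "Re s > \<alpha>"
  shows "log_remainder L s = log_remainder H s + log_remainder K s"
  using assms
  by (simp add: log_remainder_def Let_def deriv_add_halfplane[OF assms(1-3)]
      deriv_deriv_add_halfplane[OF assms(1-3)] field_simps)

text \<open>Along the real axis the imaginary part of \<open>H\<close> vanishes identically, and its
  real derivative there is the imaginary part of the complex derivative.\<close>

lemma Im_deriv_eq_0_of_real_on_Reals:
  assumes H: "H holomorphic_on {s. Re s > \<alpha>}"
    and real: "\<And>\<sigma>. \<sigma> > \<alpha> \<Longrightarrow> H (of_real \<sigma>) \<in> \<real>" and \<sigma>: "\<sigma> > \<alpha>"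
  shows "Im (deriv H (of_real \<sigma>)) = 0"
proof -
  have "(H has_field_derivative deriv H (of_real \<sigma>)) (at (of_real \<sigma>))"
    using \<sigma> by (intro holomorphic_derivI[OF H open_halfspace_Re_gt]) auto
  then have "((\<lambda>x. H (of_real x)) has_vector_derivative deriv H (of_real \<sigma>)) (at \<sigma>)"
    by (rule has_vector_derivative_real_field)
  then have "((\<lambda>x. Im (H (of_real x))) has_vector_derivative Im (deriv H (of_real \<sigma>))) (at \<sigma>)"
    by (rule bounded_linear.has_vector_derivative[OF bounded_linear_Im])
  then have "((\<lambda>x. 0) has_vector_derivative Im (deriv H (of_real \<sigma>))) (at \<sigma>)"
    by (rule has_vector_derivative_transform_within_open[of _ _ _ "{\<alpha><..}"])
      (use \<sigma> real in \<open>auto simp: complex_is_Real_iff\<close>)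
  then show ?thesis
    by (rule vector_derivative_unique_at) (rule has_vector_derivative_const)
qed

text \<open>The modulus of \<open>exp (H s)\<close> sees only the real part of the quadratic
  expansion of \<open>H\<close>. The linear term drops out because the first derivative is real on
  the real axis, the quadratic term gives the Gaussian, and the remainder costs at most the factor
  \<open>exp 1\<close>.\<close>

lemma norm_le_gaussian:
  assumes log: "is_real_log \<alpha> F H" and \<sigma>: "\<sigma> > \<alpha>"
    and R: "norm (log_remainder H (Complex \<sigma> t)) \<le> 1"
  shows "norm (F (Complex \<sigma> t)) \<le>
    exp 1 * norm (F (of_real \<sigma>)) * exp (- (Re (deriv (deriv H) (of_real \<sigma>)) * t\<^sup>2) / 2)"
proof -
  let ?b = "Re (deriv (deriv H) (of_real \<sigma>))" and ?R = "log_remainder H (Complex \<sigma> t)"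
  have a: "Im (deriv H (of_real \<sigma>)) = 0"
    using log \<sigma> unfolding is_real_log_def by (intro Im_deriv_eq_0_of_real_on_Reals) auto
  have "H (Complex \<sigma> t) = H (of_real \<sigma>) + \<i> * deriv H (of_real \<sigma>) * of_real t
      - deriv (deriv H) (of_real \<sigma>) / 2 * of_real (t\<^sup>2) + ?R"
    by (simp add: log_remainder_def Let_def)
  then have "Re (H (Complex \<sigma> t)) = Re (H (of_real \<sigma>)) - ?b * t\<^sup>2 / 2 + Re ?R"
    using a by simp
  also have "\<dots> \<le> Re (H (of_real \<sigma>)) - ?b * t\<^sup>2 / 2 + 1"
    using R complex_Re_le_cmod[of ?R] by simp
  finally have "exp (Re (H (Complex \<sigma> t))) \<le> exp (1 + Re (H (of_real \<sigma>)) + - (?b * t\<^sup>2) / 2)"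
    by simp
  then show ?thesis
    using log \<sigma> unfolding is_real_log_def exp_add by simp
qed

section \<open>Real inequalities and the tail integral\<close>

text \<open>The function \<open>x * exp (- (x * c))\<close> decreases beyond its maximum at
  \<open>1 / c\<close>. No derivatives are taken: the inequality \<open>1 + u \<le> exp u\<close> is
  used with \<open>u = (y - x) * c\<close>.\<close>

lemma mult_exp_neg_antimono:
  fixes x y c :: real
  assumes "x \<le> y" "1 \<le> x * c" "0 < x"
  shows "y * exp (- (y * c)) \<le> x * exp (- (x * c))"
proof -
  have "(y - x) * 1 \<le> (y - x) * (x * c)"
    using assms by (intro mult_left_mono) auto
  then have "y \<le> x * (1 + (y - x) * c)"
    by (simp add: algebra_simps)
  also have "\<dots> \<le> x * exp ((y - x) * c)"
    using assms exp_ge_add_one_self by (intro mult_left_mono) auto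
  finally have "y * exp (- (y * c)) \<le> x * exp ((y - x) * c) * exp (- (y * c))"
    by (intro mult_right_mono) auto
  then show ?thesis
    by (simp add: algebra_simps flip: exp_add)
qed

text \<open>
  The bound is pointwise: for \<open>d \<le> \<bar>t\<bar> \<le> d'\<close> the Gaussian factor in \<open>\<psi>\<close> absorbs \<open>c\<close>, because
  \<open>c * exp (- c * d\<^sup>2) \<le> 1 / d\<^sup>2 \<le> b\<close>.
\<close>

lemma tail_integral_mult_le:
  fixes \<phi> \<psi> w :: "real \<Rightarrow> real"
  assumes w: "integrable lborel w" "\<And>t. w t \<ge> 0"
    and \<phi>: "\<phi> \<in> borel_measurable borel" "\<And>t. 0 \<le> \<phi> t" "\<And>t. \<phi> t \<le> 1"
    and \<psi>: "\<psi> \<in> borel_measurable borel" "\<And>t. 0 \<le> \<psi> t" "\<And>t. \<psi> t \<le> 1"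
    and d: "0 < d" and bd: "1 \<le> b * d\<^sup>2" and pos: "0 < b" "0 < c"
    and gauss: "\<And>t. \<bar>t\<bar> \<le> d' \<Longrightarrow> \<psi> t \<le> C * exp (- (c * t\<^sup>2) / 2)" and C: "0 \<le> C"
  shows "sqrt (b + c) * (LINT t:{t. \<bar>t\<bar> \<ge> d}|lborel. \<phi> t * \<psi> t * w t) \<le>
    (1 + C) * (sqrt b * (LINT t:{t. \<bar>t\<bar> \<ge> d}|lborel. \<phi> t * w t)) +
    sqrt c * (LINT t:{t. \<bar>t\<bar> \<ge> d'}|lborel. \<psi> t * w t)"
proof -
  define I where "I e t = (indicator {t. \<bar>t\<bar> \<ge> e} t :: real)" for e t :: real
  have I: "I e \<in> borel_measurable borel" "0 \<le> I e t" "I e t \<le> 1" for e t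
    unfolding I_def by (auto simp: indicator_def)
  have [measurable]: "\<phi> \<in> borel_measurable borel" "\<psi> \<in> borel_measurable borel"
      "w \<in> borel_measurable borel" "I e \<in> borel_measurable borel" for e
    using \<phi> \<psi> w I by auto
  have integrable: "integrable lborel (\<lambda>t. I e t * (u t * w t))"
    if [measurable]: "u \<in> borel_measurable borel" and u: "\<And>t. 0 \<le> u t" "\<And>t. u t \<le> 1" for e u
  proof (rule Bochner_Integration.integrable_bound[OF w(1)])
    have "I e t * (u t * w t) \<le> 1 * (1 * w t)" for t
      using u I w(2) by (intro mult_mono) auto
    then show "AE t in lborel. norm (I e t * (u t * w t)) \<le> norm (w t)"
      using u I w(2) by (auto simp: abs_mult)
  qed auto
  have set_lint: "(LINT t:{t. \<bar>t\<bar> \<ge> e}|lborel. f t) = (LINT t|lborel. I e t * f t)" for e f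
    by (simp add: set_lebesgue_integral_def I_def)
  \<comment> \<open>This is the square root of \<open>c \<le> b * exp (c * t\<^sup>2)\<close>, which
    follows from \<open>1 \<le> b * t\<^sup>2\<close> and \<open>u \<le> exp u\<close>.\<close>
  have cexp: "sqrt c * exp (- (c * t\<^sup>2) / 2) \<le> sqrt b" if "d \<le> \<bar>t\<bar>" for t
  proof -
    have "d\<^sup>2 \<le> t\<^sup>2" using that d abs_le_square_iff[of d t] by simp
    then have "1 \<le> b * t\<^sup>2"
      using bd pos mult_left_mono[of "d\<^sup>2" "t\<^sup>2" b] by linarith
    then have "c \<le> c * (b * t\<^sup>2)" using pos by simp
    also have "\<dots> \<le> b * exp (c * t\<^sup>2)"
      using pos mult_left_mono[of "c * t\<^sup>2" "exp (c * t\<^sup>2)" b]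
        order_trans[OF _ exp_ge_add_one_self[of "c * t\<^sup>2"]] by (simp add: mult_ac)
    finally have "sqrt c \<le> sqrt (b * exp (c * t\<^sup>2))"
      by (rule real_sqrt_le_mono)
    also have "\<dots> = sqrt b * exp (c * t\<^sup>2 / 2)"
      by (simp add: real_sqrt_mult real_sqrt_unique power2_eq_square flip: exp_add)
    finally have "sqrt c * exp (- (c * t\<^sup>2) / 2) \<le>
        sqrt b * exp (c * t\<^sup>2 / 2) * exp (- (c * t\<^sup>2) / 2)"
      by (intro mult_right_mono) auto
    then show ?thesis by (simp add: mult.assoc flip: exp_add)
  qed
  have pointwise: "sqrt (b + c) * (I d t * (\<phi> t * \<psi> t * w t)) \<le>
      (1 + C) * (sqrt b * (I d t * (\<phi> t * w t))) + sqrt c * (I d' t * (\<psi> t * w t))" for t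
  proof (cases "d \<le> \<bar>t\<bar>")
    case True
    have \<phi>w: "0 \<le> \<phi> t * w t" and \<psi>w: "0 \<le> \<psi> t * w t"
      using \<phi> \<psi> w by auto
    have le: "\<phi> t * \<psi> t * w t \<le> \<phi> t * w t" "\<phi> t * \<psi> t * w t \<le> \<psi> t * w t"
      using \<phi>(3)[of t] \<psi>(3)[of t] mult_left_le[OF \<psi>(3) \<phi>w] mult_left_le[OF \<phi>(3) \<psi>w]
      by (simp_all add: mult_ac)
    have "sqrt (b + c) * (\<phi> t * \<psi> t * w t) \<le> (sqrt b + sqrt c) * (\<phi> t * \<psi> t * w t)"
      using pos \<phi>w \<psi>(2)[of t]
      by (intro mult_right_mono sqrt_add_le_add_sqrt) (auto simp: \<phi> \<psi> w)
    also have "\<dots> = sqrt b * (\<phi> t * \<psi> t * w t) + sqrt c * (\<phi> t * \<psi> t * w t)"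
      by (simp add: algebra_simps)
    also have "sqrt b * (\<phi> t * \<psi> t * w t) \<le> sqrt b * (\<phi> t * w t)"
      using le pos by (intro mult_left_mono) auto
    \<comment> \<open>From \<open>d'\<close> on, \<open>\<phi> \<le> 1\<close> leaves the tail of
      \<open>\<psi>\<close>; below \<open>d'\<close> the Gaussian bound trades \<open>sqrt c\<close>
      for \<open>C * sqrt b\<close>.\<close>
    also have "sqrt c * (\<phi> t * \<psi> t * w t) \<le>
        C * (sqrt b * (\<phi> t * w t)) + sqrt c * (I d' t * (\<psi> t * w t))"
    proof (cases "d' \<le> \<bar>t\<bar>")
      case True
      have "sqrt c * (\<phi> t * \<psi> t * w t) \<le> sqrt c * (\<psi> t * w t)"
        using le pos by (intro mult_left_mono) auto
      moreover have "0 \<le> C * (sqrt b * (\<phi> t * w t))"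
        using C pos \<phi>w by simp
      moreover have "I d' t = 1" using True by (simp add: I_def)
      ultimately show ?thesis by simp
    next
      case False
      have "sqrt c * (\<phi> t * \<psi> t * w t) = (sqrt c * \<psi> t) * (\<phi> t * w t)"
        by (simp add: mult_ac)
      also have "sqrt c * \<psi> t \<le> C * (sqrt c * exp (- (c * t\<^sup>2) / 2))"
        using mult_left_mono[OF gauss[of t], of "sqrt c"] False pos by (simp add: mult_ac)
      also have "\<dots> \<le> C * sqrt b"
        using cexp[OF \<open>d \<le> \<bar>t\<bar>\<close>] C by (rule mult_left_mono)
      finally show ?thesis
        using False \<phi>w by (simp add: I_def mult_right_mono mult.assoc)
    qed
    finally show ?thesis
      using True by (simp add: I_def algebra_simps)
  next
    \<comment> \<open>Here \<open>I d t = 0\<close>; the summand with \<open>I d' t\<close> can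
      survive when \<open>d' < d\<close>, but it is nonnegative.\<close>
    case False
    then show ?thesis
      using I(2)[of d' t] \<psi>(2)[of t] w(2)[of t] pos by (simp add: I_def)
  qed
  have "sqrt (b + c) * (LINT t|lborel. I d t * (\<phi> t * \<psi> t * w t)) =
      (LINT t|lborel. sqrt (b + c) * (I d t * (\<phi> t * \<psi> t * w t)))"
    by simp
  also have "\<dots> \<le> (LINT t|lborel. (1 + C) * (sqrt b * (I d t * (\<phi> t * w t))) +
      sqrt c * (I d' t * (\<psi> t * w t)))"
    by (intro integral_mono pointwise Bochner_Integration.integrable_add integrable_mult_right
        integrable) (auto simp: \<phi> \<psi> mult_le_one)
  also have "\<dots> = (1 + C) * (sqrt b * (LINT t|lborel. I d t * (\<phi> t * w t))) +
      sqrt c * (LINT t|lborel. I d' t * (\<psi> t * w t))"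
    by (subst Bochner_Integration.integral_add) (auto intro!: integrable_mult_right integrable simp: \<phi> \<psi>)
  finally show ?thesis unfolding set_lint .
qed

text \<open>Rescaling \<open>t\<close> by \<open>1 / \<sigma>\<close> reduces this to the
  integrability of \<open>1 / (1 + t\<^sup>2)\<close>.\<close>

lemma integrable_inverse_plus_square:
  fixes \<sigma> :: real
  assumes "\<sigma> > 0"
  shows "integrable lborel (\<lambda>t. 1 / (\<sigma>\<^sup>2 + t\<^sup>2))"
proof -
  have "integrable lborel (\<lambda>t. inverse (1 + t\<^sup>2) :: real)"
    using integrable_inverse_1_plus_square by (simp add: set_integrable_def)
  then have "integrable lborel (\<lambda>t. inverse (1 + (0 + inverse \<sigma> * t)\<^sup>2))"
    using assms by (intro lborel_integrable_real_affine) auto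
  then have "integrable lborel (\<lambda>t. inverse (\<sigma>\<^sup>2) * inverse (1 + (inverse \<sigma> * t)\<^sup>2))"
    by simp
  also have "(\<lambda>t. inverse (\<sigma>\<^sup>2) * inverse (1 + (inverse \<sigma> * t)\<^sup>2)) = (\<lambda>t. 1 / (\<sigma>\<^sup>2 + t\<^sup>2))"
    using assms by (intro ext) (simp add: divide_simps power_mult_distrib)
  finally show ?thesis .
qed

section \<open>The normalized tail of a product\<close>

text \<open>The quantity in (A8), with \<open>b\<close> and \<open>d\<close> left free because the
  estimate for a product compares tails at different values of both.\<close>

definition normalized_tail :: "(complex \<Rightarrow> complex) \<Rightarrow> real \<Rightarrow> real \<Rightarrow> real \<Rightarrow> real" where
  "normalized_tail F \<sigma> b d = \<sigma> * sqrt b / Re (F (of_real \<sigma>)) *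
     (LINT t:{t. \<bar>t\<bar> \<ge> d}|lborel. norm (F (Complex \<sigma> t)) / (\<sigma>\<^sup>2 + t\<^sup>2))"

lemma normalized_tail_nonneg:
  assumes "nonneg_dirichlet_series \<alpha> F" "\<sigma> > \<alpha>" "0 \<le> \<sigma>" "0 \<le> b"
  shows "0 \<le> normalized_tail F \<sigma> b d"
  unfolding normalized_tail_def set_lebesgue_integral_def
  using assms nonneg_dirichlet_series_real_pos(2)[OF assms(1,2)]
  by (intro mult_nonneg_nonneg integral_nonneg divide_nonneg_pos) auto

lemma nonneg_dirichlet_series_vertical_measurable:
  assumes "nonneg_dirichlet_series \<alpha> F" "\<sigma> > \<alpha>"
  shows "(\<lambda>t. norm (F (Complex \<sigma> t))) \<in> borel_measurable borel"
proof -
  have "continuous_on UNIV (\<lambda>t. F (Complex \<sigma> t))"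
    by (rule continuous_on_compose2[OF holomorphic_on_imp_continuous_on[OF
          nonneg_dirichlet_series_holomorphic[OF assms(1)]]])
      (use assms(2) in \<open>auto simp: Complex_eq intro!: continuous_intros\<close>)
  then show ?thesis
    by (intro borel_measurable_continuous_onI continuous_on_norm)
qed

text \<open>Dividing the moduli by the values on the real axis yields \<open>\<phi>\<close> and
  \<open>\<psi>\<close> as in \<open>tail_integral_mult_le\<close>, with \<open>C = exp 1\<close>
  from the remainder bound. The roles are asymmetric: the tail starts at the cut-off of
  \<open>F\<close>, and the Gaussian decay is that of \<open>G\<close>.\<close>

lemma normalized_tail_mult_le:
  assumes F: "nonneg_dirichlet_series \<alpha> F" and G: "nonneg_dirichlet_series \<alpha> G"
    and log: "is_real_log \<alpha> G K" and c: "c = Re (deriv (deriv K) (of_real \<sigma>))" "0 < c"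
    and \<sigma>: "\<sigma> > \<alpha>" "\<sigma> > 0" and d: "0 < d" "1 \<le> b * d\<^sup>2" and b: "0 < b"
    and R: "\<And>t. \<bar>t\<bar> \<le> d' \<Longrightarrow> norm (log_remainder K (Complex \<sigma> t)) \<le> 1"
  shows "normalized_tail (\<lambda>s. F s * G s) \<sigma> (b + c) d \<le>
    (1 + exp 1) * normalized_tail F \<sigma> b d + normalized_tail G \<sigma> c d'"
proof -
  let ?A = "Re (F (of_real \<sigma>))" and ?B = "Re (G (of_real \<sigma>))"
  define \<phi> where "\<phi> t = norm (F (Complex \<sigma> t)) / ?A" for t
  define \<psi> where "\<psi> t = norm (G (Complex \<sigma> t)) / ?B" for t
  define w where "w t = 1 / (\<sigma>\<^sup>2 + t\<^sup>2)" for t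
  note pos = nonneg_dirichlet_series_real_pos[OF F \<sigma>(1)] nonneg_dirichlet_series_real_pos[OF G \<sigma>(1)]
  have norm_G: "norm (G (of_real \<sigma>)) = ?B"
    using pos(3,4) by (simp add: cmod_eq_Re complex_is_Real_iff)
  have AB: "Re (F (of_real \<sigma>) * G (of_real \<sigma>)) = ?A * ?B"
    using pos(1,3) by (simp add: complex_is_Real_iff)
  have gauss: "\<psi> t \<le> exp 1 * exp (- (c * t\<^sup>2) / 2)" if "\<bar>t\<bar> \<le> d'" for t
    using norm_le_gaussian[OF log \<sigma>(1) R[OF that]] pos(4)
    unfolding \<psi>_def norm_G c(1)[symmetric] by (simp add: field_simps)
  have "sqrt (b + c) * (LINT t:{t. \<bar>t\<bar> \<ge> d}|lborel. \<phi> t * \<psi> t * w t) \<le>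
    (1 + exp 1) * (sqrt b * (LINT t:{t. \<bar>t\<bar> \<ge> d}|lborel. \<phi> t * w t)) +
    sqrt c * (LINT t:{t. \<bar>t\<bar> \<ge> d'}|lborel. \<psi> t * w t)"
  proof (rule tail_integral_mult_le[OF _ _ _ _ _ _ _ _ d b c(2) gauss])
    show "integrable lborel w"
      unfolding w_def using \<sigma>(2) by (rule integrable_inverse_plus_square)
    show "\<phi> \<in> borel_measurable borel" "\<psi> \<in> borel_measurable borel"
      unfolding \<phi>_def \<psi>_def
      using nonneg_dirichlet_series_vertical_measurable[OF F \<sigma>(1)]
        nonneg_dirichlet_series_vertical_measurable[OF G \<sigma>(1)] by auto
    show "\<phi> t \<le> 1" "\<psi> t \<le> 1" for t
      unfolding \<phi>_def \<psi>_def
      using norm_nonneg_dirichlet_series_le[OF F \<sigma>(1)] norm_nonneg_dirichlet_series_le[OF G \<sigma>(1)] pos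
      by (simp_all add: divide_le_eq_1_pos)
  qed (use pos in \<open>auto simp: \<phi>_def \<psi>_def w_def\<close>)
  from mult_left_mono[OF this, of \<sigma>] \<sigma>(2)
  have "\<sigma> * sqrt (b + c) * (LINT t:{t. \<bar>t\<bar> \<ge> d}|lborel. \<phi> t * \<psi> t * w t) \<le>
    (1 + exp 1) * (\<sigma> * sqrt b * (LINT t:{t. \<bar>t\<bar> \<ge> d}|lborel. \<phi> t * w t)) +
    \<sigma> * sqrt c * (LINT t:{t. \<bar>t\<bar> \<ge> d'}|lborel. \<psi> t * w t)"
    by (simp add: algebra_simps)
  moreover have "normalized_tail (\<lambda>s. F s * G s) \<sigma> (b + c) d =
      \<sigma> * sqrt (b + c) * (LINT t:{t. \<bar>t\<bar> \<ge> d}|lborel. \<phi> t * \<psi> t * w t)"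
    unfolding normalized_tail_def AB set_lebesgue_integral_def \<phi>_def \<psi>_def w_def
    by (simp add: norm_mult mult_ac flip: integral_mult_right_zero)
  moreover have "normalized_tail F \<sigma> b d = \<sigma> * sqrt b * (LINT t:{t. \<bar>t\<bar> \<ge> d}|lborel. \<phi> t * w t)"
    unfolding normalized_tail_def set_lebesgue_integral_def \<phi>_def w_def
    by (simp flip: integral_mult_right_zero)
  moreover have "normalized_tail G \<sigma> c d' = \<sigma> * sqrt c * (LINT t:{t. \<bar>t\<bar> \<ge> d'}|lborel. \<psi> t * w t)"
    unfolding normalized_tail_def set_lebesgue_integral_def \<psi>_def w_def
    by (simp flip: integral_mult_right_zero)
  ultimately show ?thesis by simp
qed

section \<open>Consequences of (A5) and (A6) near the abscissa\<close>

text \<open>For \<open>\<alpha> < \<sigma> < \<alpha> + 1\<close> the factor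
  \<open>\<sigma>\<^sup>2\<close> is positive and at most \<open>(\<alpha> + 1)\<^sup>2\<close>, so
  the growth must come from \<open>b\<close>.\<close>

lemma filterlim_at_top_of_power2_mult:
  fixes b :: "real \<Rightarrow> real"
  assumes lim: "filterlim (\<lambda>\<sigma>. \<sigma>\<^sup>2 * b \<sigma>) at_top (at_right \<alpha>)" and "0 \<le> \<alpha>"
  shows "filterlim b at_top (at_right \<alpha>)"
  unfolding filterlim_at_top_gt[of _ _ 0]
proof (intro allI impI)
  fix Z :: real assume Z: "0 < Z"
  have "eventually (\<lambda>\<sigma>. (\<alpha> + 1)\<^sup>2 * Z \<le> \<sigma>\<^sup>2 * b \<sigma>) (at_right \<alpha>)"
    using lim unfolding filterlim_at_top by blast
  moreover have "eventually (\<lambda>\<sigma>. \<sigma> \<in> {\<alpha><..<\<alpha> + 1}) (at_right \<alpha>)"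
    by (intro eventually_at_right_real) simp
  ultimately show "eventually (\<lambda>\<sigma>. Z \<le> b \<sigma>) (at_right \<alpha>)"
  proof eventually_elim
    case (elim \<sigma>)
    then have \<sigma>: "0 < \<sigma>\<^sup>2" "\<sigma>\<^sup>2 \<le> (\<alpha> + 1)\<^sup>2"
      using \<open>0 \<le> \<alpha>\<close> by (auto intro!: power_mono)
    have "\<sigma>\<^sup>2 * Z \<le> (\<alpha> + 1)\<^sup>2 * Z" using \<sigma> Z by (intro mult_right_mono) auto
    also have "\<dots> \<le> \<sigma>\<^sup>2 * b \<sigma>" using elim by simp
    finally show ?case using \<sigma> by simp
  qed
qed

text \<open>Where \<open>b x \<ge> 1\<close>, the exponential alone is at most the product in (A6),
  which is eventually below \<open>exp (-1)\<close>; comparing exponents gives the bound.\<close>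

lemma eventually_one_le_mult_power2:
  fixes b \<delta> :: "'a \<Rightarrow> real"
  assumes "((\<lambda>x. b x * exp (- (b x * (\<delta> x)\<^sup>2))) \<longlongrightarrow> 0) A" "eventually (\<lambda>x. 1 \<le> b x) A"
  shows "eventually (\<lambda>x. 1 \<le> b x * (\<delta> x)\<^sup>2) A"
proof -
  have "eventually (\<lambda>x. b x * exp (- (b x * (\<delta> x)\<^sup>2)) < exp (-1)) A"
    using assms(1) by (rule order_tendstoD) simp
  with assms(2) show ?thesis
  proof eventually_elim
    case (elim x)
    have "1 * exp (- (b x * (\<delta> x)\<^sup>2)) \<le> b x * exp (- (b x * (\<delta> x)\<^sup>2))"
      using elim by (intro mult_right_mono) auto
    with elim have "exp (- (b x * (\<delta> x)\<^sup>2)) < exp (-1)" by linarith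
    then show ?case by simp
  qed
qed

section \<open>Admissibility of the product\<close>

text \<open>For a series with coefficients \<open>f\<close> and \<open>\<sigma> > \<alpha>\<close>,
  this is the variance of \<open>log n\<close> when \<open>n\<close> is drawn with probability
  proportional to \<open>f n * n powr - \<sigma>\<close>.\<close>

definition log_variance :: "real \<Rightarrow> (complex \<Rightarrow> complex) \<Rightarrow> real \<Rightarrow> real" where
  "log_variance \<alpha> F \<sigma> = Re (deriv (deriv (real_log \<alpha> F)) (of_real \<sigma>))"

lemma admissible_iff:
  "admissible \<alpha> F \<longleftrightarrow>
     0 \<le> \<alpha> \<and> nonneg_dirichlet_series \<alpha> F \<and> (\<forall>s. Re s > \<alpha> \<longrightarrow> F s \<noteq> 0) \<and>
     (\<exists>\<beta> \<delta>. \<beta> > \<alpha> \<and> (\<forall>\<sigma>. \<alpha> < \<sigma> \<and> \<sigma> < \<beta> \<longrightarrow> 0 < \<delta> \<sigma> \<and> \<delta> \<sigma> < 1) \<and>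
        (\<delta> \<longlongrightarrow> 0) (at_right \<alpha>) \<and>
        filterlim (\<lambda>\<sigma>. \<sigma>\<^sup>2 * log_variance \<alpha> F \<sigma>) at_top (at_right \<alpha>) \<and>
        ((\<lambda>\<sigma>. log_variance \<alpha> F \<sigma> * exp (- (log_variance \<alpha> F \<sigma> * (\<delta> \<sigma>)\<^sup>2))) \<longlongrightarrow> 0) (at_right \<alpha>) \<and>
        (\<forall>\<epsilon>>0. \<forall>\<^sub>F \<sigma> in at_right \<alpha>. \<forall>t. \<bar>t\<bar> \<le> \<delta> \<sigma> \<longrightarrow>
           norm (log_remainder (real_log \<alpha> F) (Complex \<sigma> t)) < \<epsilon>) \<and>
        ((\<lambda>\<sigma>. normalized_tail F \<sigma> (log_variance \<alpha> F \<sigma>) (\<delta> \<sigma>)) \<longlongrightarrow> 0) (at_right \<alpha>))"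
  unfolding admissible_def Let_def log_variance_def normalized_tail_def ..

theorem theorem25:
  fixes F\<^sub>1 F\<^sub>2 :: "complex \<Rightarrow> complex" and \<alpha> :: real
  assumes "admissible \<alpha> F\<^sub>1" and "admissible \<alpha> F\<^sub>2"
  shows "admissible \<alpha> (\<lambda>s. F\<^sub>1 s * F\<^sub>2 s)"
proof -
  let ?G = "\<lambda>s. F\<^sub>1 s * F\<^sub>2 s"
  let ?b1 = "log_variance \<alpha> F\<^sub>1" and ?b2 = "log_variance \<alpha> F\<^sub>2" and ?b = "log_variance \<alpha> ?G"
  let ?R = "\<lambda>F \<sigma> t. norm (log_remainder (real_log \<alpha> F) (Complex \<sigma> t))"
  have \<alpha>: "0 \<le> \<alpha>" and series: "nonneg_dirichlet_series \<alpha> F\<^sub>1" "nonneg_dirichlet_series \<alpha> F\<^sub>2"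
    and nz: "\<And>s. Re s > \<alpha> \<Longrightarrow> F\<^sub>1 s \<noteq> 0" "\<And>s. Re s > \<alpha> \<Longrightarrow> F\<^sub>2 s \<noteq> 0"
    using assms unfolding admissible_iff by auto
  obtain \<beta>1 \<delta>1 where \<beta>1: "\<beta>1 > \<alpha>" "\<And>\<sigma>. \<alpha> < \<sigma> \<Longrightarrow> \<sigma> < \<beta>1 \<Longrightarrow> 0 < \<delta>1 \<sigma> \<and> \<delta>1 \<sigma> < 1"
    and A4_1: "(\<delta>1 \<longlongrightarrow> 0) (at_right \<alpha>)"
    and A5_1: "filterlim (\<lambda>\<sigma>. \<sigma>\<^sup>2 * ?b1 \<sigma>) at_top (at_right \<alpha>)"
    and A6_1: "((\<lambda>\<sigma>. ?b1 \<sigma> * exp (- (?b1 \<sigma> * (\<delta>1 \<sigma>)\<^sup>2))) \<longlongrightarrow> 0) (at_right \<alpha>)"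
    and A7_1: "\<And>\<epsilon>. \<epsilon> > 0 \<Longrightarrow> \<forall>\<^sub>F \<sigma> in at_right \<alpha>. \<forall>t. \<bar>t\<bar> \<le> \<delta>1 \<sigma> \<longrightarrow> ?R F\<^sub>1 \<sigma> t < \<epsilon>"
    and A8_1: "((\<lambda>\<sigma>. normalized_tail F\<^sub>1 \<sigma> (?b1 \<sigma>) (\<delta>1 \<sigma>)) \<longlongrightarrow> 0) (at_right \<alpha>)"
    using assms(1) unfolding admissible_iff by blast
  obtain \<beta>2 \<delta>2 where \<beta>2: "\<beta>2 > \<alpha>" "\<And>\<sigma>. \<alpha> < \<sigma> \<Longrightarrow> \<sigma> < \<beta>2 \<Longrightarrow> 0 < \<delta>2 \<sigma> \<and> \<delta>2 \<sigma> < 1"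
    and A4_2: "(\<delta>2 \<longlongrightarrow> 0) (at_right \<alpha>)"
    and A5_2: "filterlim (\<lambda>\<sigma>. \<sigma>\<^sup>2 * ?b2 \<sigma>) at_top (at_right \<alpha>)"
    and A6_2: "((\<lambda>\<sigma>. ?b2 \<sigma> * exp (- (?b2 \<sigma> * (\<delta>2 \<sigma>)\<^sup>2))) \<longlongrightarrow> 0) (at_right \<alpha>)"
    and A7_2: "\<And>\<epsilon>. \<epsilon> > 0 \<Longrightarrow> \<forall>\<^sub>F \<sigma> in at_right \<alpha>. \<forall>t. \<bar>t\<bar> \<le> \<delta>2 \<sigma> \<longrightarrow> ?R F\<^sub>2 \<sigma> t < \<epsilon>"
    and A8_2: "((\<lambda>\<sigma>. normalized_tail F\<^sub>2 \<sigma> (?b2 \<sigma>) (\<delta>2 \<sigma>)) \<longlongrightarrow> 0) (at_right \<alpha>)"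
    using assms(2) unfolding admissible_iff by blast
  define \<delta> where "\<delta> \<sigma> = min (\<delta>1 \<sigma>) (\<delta>2 \<sigma>)" for \<sigma>

  have seriesG: "nonneg_dirichlet_series \<alpha> ?G"
    using series by (rule nonneg_dirichlet_series_mult)
  have logs: "is_real_log \<alpha> F\<^sub>1 (real_log \<alpha> F\<^sub>1)" "is_real_log \<alpha> F\<^sub>2 (real_log \<alpha> F\<^sub>2)"
      "is_real_log \<alpha> ?G (real_log \<alpha> ?G)"
    using series seriesG nz by (auto intro!: nonneg_dirichlet_series_is_real_log)
  then have hol: "real_log \<alpha> F\<^sub>1 holomorphic_on {s. Re s > \<alpha>}"
      "real_log \<alpha> F\<^sub>2 holomorphic_on {s. Re s > \<alpha>}"
    unfolding is_real_log_def by auto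
  \<comment> \<open>The sum of the two real logarithms is a real logarithm of the product, so
    uniqueness identifies it with the chosen one.\<close>
  have log_add: "real_log \<alpha> ?G s = real_log \<alpha> F\<^sub>1 s + real_log \<alpha> F\<^sub>2 s" if "Re s > \<alpha>" for s
    by (rule is_real_log_unique[OF logs(3) is_real_log_mult[OF logs(1,2)] that])
  have b_add: "?b \<sigma> = ?b1 \<sigma> + ?b2 \<sigma>" if "\<sigma> > \<alpha>" for \<sigma>
    unfolding log_variance_def using that by (subst deriv_deriv_add_halfplane[OF hol log_add]) auto

  have right: "\<forall>\<^sub>F \<sigma> in at_right \<alpha>. \<alpha> < \<sigma> \<and> \<sigma> < min \<beta>1 \<beta>2"
    using eventually_at_right_real[of \<alpha> "min \<beta>1 \<beta>2"] \<beta>1(1) \<beta>2(1) by simp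
  have b1: "\<forall>\<^sub>F \<sigma> in at_right \<alpha>. 1 \<le> ?b1 \<sigma>" and b2: "\<forall>\<^sub>F \<sigma> in at_right \<alpha>. 1 \<le> ?b2 \<sigma>"
    using filterlim_at_top_of_power2_mult[OF A5_1 \<alpha>] filterlim_at_top_of_power2_mult[OF A5_2 \<alpha>]
    unfolding filterlim_at_top by blast+
  note regular = right b1 b2 eventually_one_le_mult_power2[OF A6_1 b1]
    eventually_one_le_mult_power2[OF A6_2 b2]

  have A4: "(\<delta> \<longlongrightarrow> 0) (at_right \<alpha>)"
    using tendsto_min[OF A4_1 A4_2] unfolding \<delta>_def by simp

  have "\<forall>\<^sub>F \<sigma> in at_right \<alpha>. \<sigma>\<^sup>2 * ?b1 \<sigma> + \<sigma>\<^sup>2 * ?b2 \<sigma> = \<sigma>\<^sup>2 * ?b \<sigma>"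
    using right by eventually_elim (simp add: b_add algebra_simps)
  then have A5: "filterlim (\<lambda>\<sigma>. \<sigma>\<^sup>2 * ?b \<sigma>) at_top (at_right \<alpha>)"
    using filterlim_at_top_add_at_top[OF A5_1 A5_2] by (simp cong: filterlim_cong)

  have "((\<lambda>\<sigma>. ?b1 \<sigma> * exp (- (?b1 \<sigma> * (\<delta>1 \<sigma>)\<^sup>2)) + ?b2 \<sigma> * exp (- (?b2 \<sigma> * (\<delta>2 \<sigma>)\<^sup>2)))
      \<longlongrightarrow> 0) (at_right \<alpha>)"
    using tendsto_add[OF A6_1 A6_2] by simp
  then have A6: "((\<lambda>\<sigma>. ?b \<sigma> * exp (- (?b \<sigma> * (\<delta> \<sigma>)\<^sup>2))) \<longlongrightarrow> 0) (at_right \<alpha>)"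
  proof (rule tendsto_sandwich[rotated 3])
    show "\<forall>\<^sub>F \<sigma> in at_right \<alpha>. 0 \<le> ?b \<sigma> * exp (- (?b \<sigma> * (\<delta> \<sigma>)\<^sup>2))"
      using regular by eventually_elim (simp add: b_add)
    show "\<forall>\<^sub>F \<sigma> in at_right \<alpha>. ?b \<sigma> * exp (- (?b \<sigma> * (\<delta> \<sigma>)\<^sup>2)) \<le>
        ?b1 \<sigma> * exp (- (?b1 \<sigma> * (\<delta>1 \<sigma>)\<^sup>2)) + ?b2 \<sigma> * exp (- (?b2 \<sigma> * (\<delta>2 \<sigma>)\<^sup>2))"
      using regular
    proof eventually_elim
      case (elim \<sigma>)
      \<comment> \<open>With either cut-off held fixed, passing from its own variance to the larger
        sum only decreases the expression.\<close>
      have "?b \<sigma> * exp (- (?b \<sigma> * (\<delta>1 \<sigma>)\<^sup>2)) \<le> ?b1 \<sigma> * exp (- (?b1 \<sigma> * (\<delta>1 \<sigma>)\<^sup>2))"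
        "?b \<sigma> * exp (- (?b \<sigma> * (\<delta>2 \<sigma>)\<^sup>2)) \<le> ?b2 \<sigma> * exp (- (?b2 \<sigma> * (\<delta>2 \<sigma>)\<^sup>2))"
        using elim by (auto intro!: mult_exp_neg_antimono simp: b_add)
      moreover have "0 \<le> ?b1 \<sigma> * exp (- (?b1 \<sigma> * (\<delta>1 \<sigma>)\<^sup>2))"
        "0 \<le> ?b2 \<sigma> * exp (- (?b2 \<sigma> * (\<delta>2 \<sigma>)\<^sup>2))"
        using elim by auto
      \<comment> \<open>The minimum equals one of the two cut-offs; the other summand is
        nonnegative.\<close>
      ultimately show ?case
        by (cases "\<delta>1 \<sigma> \<le> \<delta>2 \<sigma>") (auto simp: \<delta>_def min_def)
    qed
  qed simp

  have A7: "\<forall>\<^sub>F \<sigma> in at_right \<alpha>. \<forall>t. \<bar>t\<bar> \<le> \<delta> \<sigma> \<longrightarrow> ?R ?G \<sigma> t < \<epsilon>" if "\<epsilon> > 0" for \<epsilon>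
    using right A7_1[OF half_gt_zero[OF that]] A7_2[OF half_gt_zero[OF that]]
  proof eventually_elim
    case (elim \<sigma>)
    show ?case
    proof (intro allI impI)
      fix t assume t: "\<bar>t\<bar> \<le> \<delta> \<sigma>"
      have "?R ?G \<sigma> t \<le> ?R F\<^sub>1 \<sigma> t + ?R F\<^sub>2 \<sigma> t"
        using elim by (subst log_remainder_add[OF hol log_add]) (auto intro: norm_triangle_ineq)
      moreover have "?R F\<^sub>1 \<sigma> t < \<epsilon> / 2" "?R F\<^sub>2 \<sigma> t < \<epsilon> / 2"
        using elim t by (auto simp: \<delta>_def)
      ultimately show "?R ?G \<sigma> t < \<epsilon>" by linarith
    qed
  qed

  let ?J1 = "\<lambda>\<sigma>. normalized_tail F\<^sub>1 \<sigma> (?b1 \<sigma>) (\<delta>1 \<sigma>)"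
  let ?J2 = "\<lambda>\<sigma>. normalized_tail F\<^sub>2 \<sigma> (?b2 \<sigma>) (\<delta>2 \<sigma>)"
  \<comment> \<open>The majorant is symmetric because the smaller of \<open>\<delta>1\<close> and
    \<open>\<delta>2\<close> may change with \<open>\<sigma>\<close>; it dominates the bounds of
    both cases.\<close>
  have "((\<lambda>\<sigma>. (1 + exp 1) * (?J1 \<sigma> + ?J2 \<sigma>)) \<longlongrightarrow> 0) (at_right \<alpha>)"
    using tendsto_mult_left[OF tendsto_add[OF A8_1 A8_2], of "1 + exp 1"] by simp
  then have A8: "((\<lambda>\<sigma>. normalized_tail ?G \<sigma> (?b \<sigma>) (\<delta> \<sigma>)) \<longlongrightarrow> 0) (at_right \<alpha>)"
  proof (rule tendsto_sandwich[rotated 3])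
    show "\<forall>\<^sub>F \<sigma> in at_right \<alpha>. 0 \<le> normalized_tail ?G \<sigma> (?b \<sigma>) (\<delta> \<sigma>)"
      using regular by eventually_elim (use \<alpha> in \<open>auto simp: b_add intro!: normalized_tail_nonneg[OF seriesG]\<close>)
    show "\<forall>\<^sub>F \<sigma> in at_right \<alpha>. normalized_tail ?G \<sigma> (?b \<sigma>) (\<delta> \<sigma>) \<le> (1 + exp 1) * (?J1 \<sigma> + ?J2 \<sigma>)"
      \<comment> \<open>Condition (A7) with \<open>\<epsilon> = 1\<close> supplies the remainder
        bound behind the Gaussian estimate.\<close>
      using regular A7_1[OF zero_less_one] A7_2[OF zero_less_one]
    proof eventually_elim
      case (elim \<sigma>)
      have J: "0 \<le> ?J1 \<sigma>" "0 \<le> ?J2 \<sigma>"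
        using elim \<alpha> by (auto intro!: normalized_tail_nonneg[OF series(1)]
            normalized_tail_nonneg[OF series(2)])
      have \<delta>: "0 < \<delta>1 \<sigma>" "0 < \<delta>2 \<sigma>" using elim \<beta>1(2)[of \<sigma>] \<beta>2(2)[of \<sigma>] by auto
      show ?case
      proof (cases "\<delta>1 \<sigma> \<le> \<delta>2 \<sigma>")
        case True
        have "normalized_tail ?G \<sigma> (?b1 \<sigma> + ?b2 \<sigma>) (\<delta>1 \<sigma>) \<le> (1 + exp 1) * ?J1 \<sigma> + ?J2 \<sigma>"
          by (rule normalized_tail_mult_le[OF series logs(2) log_variance_def])
            (use elim \<alpha> \<delta> in \<open>auto intro: less_imp_le\<close>)
        also have "\<dots> \<le> (1 + exp 1) * (?J1 \<sigma> + ?J2 \<sigma>)"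
          using J by (simp add: algebra_simps)
        finally show ?thesis using True elim by (simp add: \<delta>_def b_add)
      next
        case False
        \<comment> \<open>The factors are exchanged so that the smaller cut-off again belongs to the
          first one.\<close>
        have "normalized_tail (\<lambda>s. F\<^sub>2 s * F\<^sub>1 s) \<sigma> (?b2 \<sigma> + ?b1 \<sigma>) (\<delta>2 \<sigma>) \<le>
            (1 + exp 1) * ?J2 \<sigma> + ?J1 \<sigma>"
          by (rule normalized_tail_mult_le[OF series(2,1) logs(1) log_variance_def])
            (use elim \<alpha> \<delta> in \<open>auto intro: less_imp_le\<close>)
        also have "\<dots> \<le> (1 + exp 1) * (?J1 \<sigma> + ?J2 \<sigma>)"
          using J by (simp add: algebra_simps)
        finally show ?thesis using False elim by (simp add: \<delta>_def b_add mult.commute add.commute)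
      qed
    qed
  qed simp

  have "0 < \<delta> \<sigma> \<and> \<delta> \<sigma> < 1" if "\<alpha> < \<sigma> \<and> \<sigma> < min \<beta>1 \<beta>2" for \<sigma>
    using \<beta>1(2)[of \<sigma>] \<beta>2(2)[of \<sigma>] that unfolding \<delta>_def by linarith
  then show ?thesis
    unfolding admissible_iff
    using \<alpha> seriesG nz \<beta>1(1) \<beta>2(1) A4 A5 A6 A7 A8
    by (intro conjI exI[of _ "min \<beta>1 \<beta>2"] exI[of _ \<delta>]) simp_all
qed

end
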